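(* Let $\phi_t\in\mathbb{R}^{S\times d_\phi}$ and $\psi_t\in\mathbb{R}^{S\times d_\psi}$, $t\ge0$, be differentiable in $t$ and, together with predictors $T_{\phi,z,t}\in\mathbb{R}^{d_\phi\times d_\psi}$ and $T_{\psi,z,t}\in\mathbb{R}^{d_\psi\times d_\phi}$ ($z\in\mathcal{Z}$), satisfy for all $t\ge0$ the system $$\begin{cases}T_{\phi,z,t}\in\arg\min_{T_z}\mathcal{L}_{\mathrm{TD}}(\phi_t,T_z,\psi_t),\\ T_{\psi,z,t}\in\arg\min_{T_z}\mathcal{L}_{\mathrm{TD}}(\psi_t,T_z,\phi_t),\\ \dot\phi_t=-\nabla_{\phi_t}\mathcal{L}_{\mathrm{TD}}(\phi_t,T_{\phi,z,t},\psi_t),\\ \dot\psi_t=-\nabla_{\psi_t}\mathcal{L}_{\mathrm{TD}}(\psi_t,T_{\psi,z,t},\phi_t).\end{cases}$$ Then the covariance matrices are constant over time: $\phi_t^\top\phi_t=\phi_0^\top\phi_0$ and $\psi_t^\top\psi_t=\psi_0^\top\psi_0$ for all $t\ge0$.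
   Context: Setting: a finite Markov decision process with $S$ states, transition probabilities $P(s'\mid s,a)$ and discount factor $\gamma\in[0,1)$; a probability distribution $\rho$ on states; a finite index set $\mathcal{Z}$ with a probability distribution $p$; policies $\pi_z$, $z\in\mathcal{Z}$, with $P^{\pi_z}(s'\mid s)=P(s'\mid s,\pi_z(s))$. For a matrix $\phi\in\mathbb{R}^{S\times d}$, $\phi(s)\in\mathbb{R}^d$ denotes row $s$ as a column vector. The (temporal-difference latent-predictive) loss is $$\mathcal{L}_{\mathrm{TD}}(\phi,T_z,\psi)=\tfrac12\,\mathbb{E}_{z\sim p,\;s\sim\rho,\;s^+\sim P^{\pi_z}(\cdot\mid s)}\Big[\big\|T_z^\top\phi(s)-\overline{\psi(s^+)}-\gamma\,\overline{T_z^\top\phi(s^+)}\big\|_2^2\Big],\qquad T_z\in\mathbb{R}^{d_\phi\times d_\psi},$$ where an overline denotes stop-gradient: the overlined quantity has its usual value but is treated as a constant when differentiating or minimizing. $\mathcal{L}_{\mathrm{TD}}(\psi,T_z,\phi)$ is the same loss with the roles of $\phi$ and $\psi$ exchanged, with $T_z\in\mathbb{R}^{d_\psi\times d_\phi}$. The argument $T_z$ stands for the whole collection $\{T_z\}_{z\in\mathcal{Z}}$. Accordingly, $T_z\in\arg\min\mathcal{L}_{\mathrm{TD}}(\phi,T_z,\psi)$ means that $\{T_z\}_z$ minimizes the loss when the overlined targets are held fixed at the values given by $\{T_z\}_z$ itself; equivalently, the stop-gradient gradient $\nabla_{T_z}\mathcal{L}_{\mathrm{TD}}(\phi,T_z,\psi)$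 vanishes for every $z$. Gradients $\nabla_\phi,\nabla_\psi$ are Euclidean matrix gradients taken with the overlined quantities held constant. *)

theory Defs
  imports "HOL-Probability.Probability_Mass_Function" "HOL-Analysis.Analysis"
begin

(* An m x n matrix has type real^'n^'m, so "phi $ s" is row s of phi as a column vector.

   Stop-gradient is encoded by splitting each role of an argument: phi and T are the live
   occurrences, while phib, Tb, psib are the overlined ones.  The value of the loss
   L_TD(phi, T, psi) is  td_loss P rho p pi gamma phi T phi T psi; differentiating or minimizing
   in phi or T means varying only the live occurrence.  The last argument psi occurs only under
   an overline. *)
definition td_loss ::
  "('s::finite \<Rightarrow> 'a \<Rightarrow> 's pmf) \<Rightarrow> 's pmf \<Rightarrow> 'z pmf \<Rightarrow> ('z \<Rightarrow> 's \<Rightarrow> 'a) \<Rightarrow> real \<Rightarrow>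
   real^'m^'s \<Rightarrow> ('z \<Rightarrow> real^'n^'m) \<Rightarrow>
   real^'m^'s \<Rightarrow> ('z \<Rightarrow> real^'n^'m) \<Rightarrow> real^'n^'s \<Rightarrow> real"
  where
  "td_loss P \<rho> p \<pi> \<gamma> \<phi> T \<phi>b Tb \<psi>b =
     1 / 2 * measure_pmf.expectation p (\<lambda>z. measure_pmf.expectation \<rho> (\<lambda>s.
       measure_pmf.expectation (P s (\<pi> z s)) (\<lambda>s'.
         (norm (transpose (T z) *v (\<phi> $ s) - \<psi>b $ s'
                - \<gamma> *\<^sub>R (transpose (Tb z) *v (\<phi>b $ s'))))\<^sup>2)))"

(* T minimizes the loss over all predictor families when the targets are frozen at the values
   given by T itself. *)
definition td_argmin ::
  "('s::finite \<Rightarrow> 'a \<Rightarrow> 's pmf) \<Rightarrow> 's pmf \<Rightarrow> 'z pmf \<Rightarrow> ('z \<Rightarrow> 's \<Rightarrow> 'a) \<Rightarrow> real \<Rightarrow>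
   real^'m^'s \<Rightarrow> ('z \<Rightarrow> real^'n^'m) \<Rightarrow> real^'n^'s \<Rightarrow> bool"
  where
  "td_argmin P \<rho> p \<pi> \<gamma> \<phi> T \<psi> \<longleftrightarrow>
     is_arg_min (\<lambda>U. td_loss P \<rho> p \<pi> \<gamma> \<phi> U \<phi> T \<psi>) (\<lambda>_. True) T"

(* G is the stop-gradient gradient of L_TD(phi, T, psi) with respect to phi.  The inner product
   on real^'m^'s is the Frobenius one, so GDERIV is the Euclidean matrix gradient. *)
definition td_gradient ::
  "('s::finite \<Rightarrow> 'a \<Rightarrow> 's pmf) \<Rightarrow> 's pmf \<Rightarrow> 'z pmf \<Rightarrow> ('z \<Rightarrow> 's \<Rightarrow> 'a) \<Rightarrow> real \<Rightarrow>
   real^'m^'s \<Rightarrow> ('z \<Rightarrow> real^'n^'m) \<Rightarrow> real^'n^'s \<Rightarrow> real^'m^'s \<Rightarrow> bool"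
  where
  "td_gradient P \<rho> p \<pi> \<gamma> \<phi> T \<psi> G \<longleftrightarrow>
     GDERIV (\<lambda>X. td_loss P \<rho> p \<pi> \<gamma> X T \<phi> T \<psi>) \<phi> :> G"

end

theory Submission
  imports Defs
begin

text \<open>The loss sees \<open>\<phi>\<close> and \<open>T\<close> only through the product \<open>\<phi> T\<^sub>z\<close>, so moving \<open>\<phi>\<close> in a direction \<open>\<phi> B\<close> has
the same effect as moving every \<open>T\<^sub>z\<close> in the direction \<open>B T\<^sub>z\<close>.  Since \<open>T\<close> is a minimizer, the
directional derivative vanishes, i.e. the gradient \<open>G\<close> satisfies \<open>\<phi>\<^sup>T G = 0\<close>.  Along the flow
\<open>\<phi>' = - G\<close> this makes \<open>\<phi>\<^sup>T \<phi>\<close> stationary.\<close>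

lemma td_loss_mult_assoc:
  "td_loss P \<rho> p \<pi> \<gamma> (X ** B) T \<phi>b Tb \<psi>b = td_loss P \<rho> p \<pi> \<gamma> X (\<lambda>z. B ** T z) \<phi>b Tb \<psi>b"
proof -
  have "transpose (T z) *v ((X ** B) $ s) = transpose (B ** T z) *v (X $ s)" for z s
  proof -
    have "(X ** B) $ s = transpose B *v (X $ s)"
      by (simp add: vec_eq_iff matrix_matrix_mult_def matrix_vector_mult_def transpose_def mult.commute)
    then show ?thesis
      by (simp add: matrix_transpose_mul matrix_vector_mul_assoc del: transpose_matrix_vector)
  qed
  then show ?thesis
    by (simp add: td_loss_def)
qed

text \<open>Adjointness for the Frobenius inner product; it moves \<open>X\<close> off the
  direction, so that a vanishing directional derivative becomes a statement about
  \<open>transpose X ** G\<close>.\<close>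

lemma inner_matrix_mult_adjoint:
  fixes G :: "real^'m^'s" and X :: "real^'k^'s" and B :: "real^'m^'k"
  shows "G \<bullet> (X ** B) = (transpose X ** G) \<bullet> B"
proof -
  have "G \<bullet> (X ** B) = (\<Sum>s\<in>UNIV. \<Sum>j\<in>UNIV. \<Sum>i\<in>UNIV. X$s$i * G$s$j * B$i$j)"
    by (simp add: inner_vec_def matrix_matrix_mult_def sum_distrib_left mult_ac)
  also have "\<dots> = (\<Sum>s\<in>UNIV. \<Sum>i\<in>UNIV. \<Sum>j\<in>UNIV. X$s$i * G$s$j * B$i$j)"
    by (intro sum.cong refl sum.swap)
  also have "\<dots> = (\<Sum>i\<in>UNIV. \<Sum>s\<in>UNIV. \<Sum>j\<in>UNIV. X$s$i * G$s$j * B$i$j)"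
    by (rule sum.swap)
  also have "\<dots> = (\<Sum>i\<in>UNIV. \<Sum>j\<in>UNIV. \<Sum>s\<in>UNIV. X$s$i * G$s$j * B$i$j)"
    by (intro sum.cong refl sum.swap)
  also have "\<dots> = (transpose X ** G) \<bullet> B"
    by (simp add: inner_vec_def matrix_matrix_mult_def transpose_def sum_distrib_right)
  finally show ?thesis .
qed

lemma td_gradient_orthogonal:
  fixes \<phi> G :: "real^'m^'s::finite"
  assumes argmin: "td_argmin P \<rho> p \<pi> \<gamma> \<phi> T \<psi>"
    and gradient: "td_gradient P \<rho> p \<pi> \<gamma> \<phi> T \<psi> G"
  shows "transpose \<phi> ** G = 0"
proof -
  \<comment> \<open>With this choice the derivative along \<open>\<phi> ** B\<close> equals
    \<open>B \<bullet> B\<close>, so a single direction suffices.\<close>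
  define B where "B = transpose \<phi> ** G"
  define L where "L X = td_loss P \<rho> p \<pi> \<gamma> X T \<phi> T \<psi>" for X
  have direction: "\<phi> + h *\<^sub>R (\<phi> ** B) = \<phi> ** (mat 1 + h *\<^sub>R B)" for h
    by (simp add: matrix_add_ldistrib scalar_matrix_assoc matrix_scalar_ac)
  \<comment> \<open>The factor \<open>mat 1 + h *\<^sub>R B\<close> is absorbed into the predictors,
    giving a competitor of \<open>T\<close> against the same frozen targets.\<close>
  have min: "L \<phi> \<le> L (\<phi> + h *\<^sub>R (\<phi> ** B))" for h
    using argmin unfolding L_def direction td_loss_mult_assoc td_argmin_def is_arg_min_def
    by (simp add: not_less)
  \<comment> \<open>The base point is written as the value of the line at \<open>h = 0\<close>, the
    form the chain rule expects.\<close>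
  have "(L has_derivative (\<lambda>H. H \<bullet> G)) (at (\<phi> + 0 *\<^sub>R (\<phi> ** B)))"
    using gradient by (simp add: td_gradient_def gderiv_def L_def[abs_def])
  then have "((\<lambda>h. L (\<phi> + h *\<^sub>R (\<phi> ** B))) has_derivative (\<lambda>h. (h *\<^sub>R (\<phi> ** B)) \<bullet> G)) (at 0)"
    by (rule has_derivative_compose[rotated]) (auto intro!: derivative_eq_intros)
  then have "((\<lambda>h. L (\<phi> + h *\<^sub>R (\<phi> ** B))) has_real_derivative ((\<phi> ** B) \<bullet> G)) (at 0)"
    by (simp add: has_field_derivative_def mult_commute_abs)
  \<comment> \<open>The minimum over \<open>h\<close> is global, so the radius 1 is
    arbitrary.\<close>
  then have "(\<phi> ** B) \<bullet> G = 0"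
    by (rule DERIV_local_min[where d = 1]) (simp_all add: min)
  then have "B \<bullet> B = 0"
    using inner_matrix_mult_adjoint[of G \<phi> B] by (simp add: inner_commute flip: B_def)
  then show ?thesis
    by (simp add: B_def)
qed

lemma bounded_bilinear_matrix_mult:
  "bounded_bilinear ((**) :: real^'m^'n \<Rightarrow> real^'k^'m \<Rightarrow> real^'k^'n)"
proof -
  have "linear (\<lambda>B :: real^'k^'m. A ** B)" for A :: "real^'m^'n"
    by (rule linearI) (simp_all add: matrix_add_ldistrib matrix_scalar_ac scalar_matrix_assoc)
  moreover have "linear (\<lambda>A :: real^'m^'n. A ** B)" for B :: "real^'k^'m"
    by (rule linearI)
      (simp_all add: vec_eq_iff matrix_matrix_mult_def distrib_right sum.distrib sum_distrib_left mult.assoc)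
  ultimately show ?thesis
    by (simp add: bilinear_conv_bounded_bilinear[symmetric] bilinear_def)
qed

text \<open>By the product rule, the derivative of the covariance is
  \<open>transpose (\<phi> t) ** \<phi>' t\<close> plus its own transpose, and \<open>orth\<close>
  kills both terms.\<close>

lemma covariance_constant:
  fixes \<phi> :: "real \<Rightarrow> real^'m^'s"
  assumes deriv: "\<And>t. t \<ge> 0 \<Longrightarrow> (\<phi> has_vector_derivative \<phi>' t) (at t within {0..})"
    and orth: "\<And>t. t \<ge> 0 \<Longrightarrow> transpose (\<phi> t) ** \<phi>' t = 0"
    and "t \<ge> 0"
  shows "transpose (\<phi> t) ** \<phi> t = transpose (\<phi> 0) ** \<phi> 0"
proof -
  have "((\<lambda>t. transpose (\<phi> t) ** \<phi> t) has_vector_derivative 0) (at t within {0..})" if "t \<ge> 0" for t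
  proof -
    have "linear (transpose :: real^'m^'s \<Rightarrow> real^'s^'m)"
      by (rule linearI) (simp_all add: transpose_def vec_eq_iff)
    then have tr: "((\<lambda>t. transpose (\<phi> t)) has_vector_derivative transpose (\<phi>' t)) (at t within {0..})"
      using bounded_linear.has_vector_derivative deriv[OF that] linear_conv_bounded_linear by blast
    have "transpose (\<phi>' t) ** \<phi> t = transpose (transpose (\<phi> t) ** \<phi>' t)"
      by (simp add: matrix_transpose_mul)
    also have "\<dots> = 0"
      using orth[OF that] by (simp add: transpose_def vec_eq_iff)
    finally show ?thesis
      using bounded_bilinear.has_vector_derivative[OF bounded_bilinear_matrix_mult tr deriv[OF that]]
        orth[OF that] by simp
  qed
  \<comment> \<open>The half-line is convex, so a zero derivative within it (one-sided at 0) forces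
    constancy.\<close>
  then obtain c where "\<And>t. t \<in> {0..} \<Longrightarrow> transpose (\<phi> t) ** \<phi> t = c"
    by (rule has_vector_derivative_zero_constant[of "{0..}", rotated]) auto
  then show ?thesis
    using \<open>t \<ge> 0\<close> by simp
qed

lemma matrix_mult_uminus_right: "A ** (- B) = - (A ** B)" for A :: "real^'m^'n" and B :: "real^'k^'m"
  by (rule bounded_bilinear.minus_right[OF bounded_bilinear_matrix_mult])

theorem theorem2:
  fixes P :: "'s::finite \<Rightarrow> 'a::finite \<Rightarrow> 's pmf"
    and \<rho> :: "'s pmf"
    and p :: "'z::finite pmf"
    and \<pi> :: "'z \<Rightarrow> 's \<Rightarrow> 'a"
    and \<gamma> :: real
    and \<phi> \<phi>' :: "real \<Rightarrow> real^'m^'s"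
    and \<psi> \<psi>' :: "real \<Rightarrow> real^'n^'s"
    and T\<phi> :: "real \<Rightarrow> 'z \<Rightarrow> real^'n^'m"
    and T\<psi> :: "real \<Rightarrow> 'z \<Rightarrow> real^'m^'n"
  assumes "0 \<le> \<gamma>" and "\<gamma> < 1"
    and "\<And>t. t \<ge> 0 \<Longrightarrow> (\<phi> has_vector_derivative \<phi>' t) (at t within {0..})"
    and "\<And>t. t \<ge> 0 \<Longrightarrow> (\<psi> has_vector_derivative \<psi>' t) (at t within {0..})"
    and "\<And>t. t \<ge> 0 \<Longrightarrow> td_argmin P \<rho> p \<pi> \<gamma> (\<phi> t) (T\<phi> t) (\<psi> t)"
    and "\<And>t. t \<ge> 0 \<Longrightarrow> td_argmin P \<rho> p \<pi> \<gamma> (\<psi> t) (T\<psi> t) (\<phi> t)"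
    and "\<And>t. t \<ge> 0 \<Longrightarrow> td_gradient P \<rho> p \<pi> \<gamma> (\<phi> t) (T\<phi> t) (\<psi> t) (- \<phi>' t)"
    and "\<And>t. t \<ge> 0 \<Longrightarrow> td_gradient P \<rho> p \<pi> \<gamma> (\<psi> t) (T\<psi> t) (\<phi> t) (- \<psi>' t)"
  shows "\<forall>t\<ge>0. transpose (\<phi> t) ** \<phi> t = transpose (\<phi> 0) ** \<phi> 0 \<and>
                transpose (\<psi> t) ** \<psi> t = transpose (\<psi> 0) ** \<psi> 0"
proof (intro allI impI conjI)
  fix t :: real
  assume t: "t \<ge> 0"
  \<comment> \<open>Orthogonality holds at each fixed time whatever the target
    \<open>\<psi> t\<close> is, so the coupled flow splits into two separate arguments. The gradient
    is \<open>- \<phi>' t\<close>, and its sign does not affect vanishing.\<close>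
  have "transpose (\<phi> t) ** \<phi>' t = 0" if "t \<ge> 0" for t
    using td_gradient_orthogonal[OF assms(5)[OF that] assms(7)[OF that]]
    by (simp add: matrix_mult_uminus_right)
  then show "transpose (\<phi> t) ** \<phi> t = transpose (\<phi> 0) ** \<phi> 0"
    using covariance_constant[OF assms(3)] t by blast
  have "transpose (\<psi> t) ** \<psi>' t = 0" if "t \<ge> 0" for t
    using td_gradient_orthogonal[OF assms(6)[OF that] assms(8)[OF that]]
    by (simp add: matrix_mult_uminus_right)
  then show "transpose (\<psi> t) ** \<psi> t = transpose (\<psi> 0) ** \<psi> 0"
    using covariance_constant[OF assms(4)] t by blast
qed

end
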